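(* Let $N\ge1$ and let $S=\{\phi_1,\dots,\phi_s\}$ be a finite set of $s$ endomorphisms of $\mathbb{P}^N$ defined over $\overline{\mathbb{Q}}$, all of degree at least $2$. Suppose that the monoid $M_S$ is commutative and that $S$ is a free basis (of cardinality $s$) of the commutative monoid $M_S$. Let $P\in\mathbb{P}^N(\overline{\mathbb{Q}})$ satisfy $h(P)>B_S:=C_S/(d_S-1)$. Then $$\lim_{B\to\infty}\frac{\#\{f\in M_S:h(f(P))\le B\}}{(\log B)^s}=\frac{1}{s!\cdot\prod_{i=1}^s\log\deg(\phi_i)}.$$
   Context: $h:\mathbb{P}^N(\overline{\mathbb{Q}})\to\mathbb{R}_{\ge0}$ is the absolute logarithmic Weil height. $M_S$ is the monoid generated by $S$ and the identity under composition. For an endomorphism $\phi$ of $\mathbb{P}^N$ of degree $d_\phi=\deg(\phi)$ (degree of its defining homogeneous polynomials), $C(\phi)=\sup_{P\in\mathbb{P}^N(\overline{\mathbb{Q}})}|h(\phi(P))-d_\phi h(P)|<\infty$; $d_S=\inf\{d_\phi:\phi\in S\}$ and $C_S=\sup\{C(\phi):\phi\in S\}$. $S$ is a free basis of the commutative monoid $M_S$ means that every $f\in M_S$ can be written uniquely as $\phi_1^{e_1}\circ\cdots\circ\phi_s^{e_s}$ with integers $e_i\ge0$ (so $M_S\cong(\mathbb{Z}_{\ge0})^s$). *)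

theory Defs
  imports "HOL-Analysis.Analysis" "HOL-Algebra.Algebraic_Closure_Type"
    "HOL-Library.Poly_Mapping"
begin

type_synonym qbar = "rat alg_closure"


section \<open>Projective space over the algebraic numbers\<close>

text \<open>The homogeneous coordinates are indexed by a finite type \<open>'n\<close>, so that \<open>'n proj\<close> is
  projective space of dimension \<open>CARD('n) - 1\<close>.\<close>

definition proj_rel :: "('n::finite \<Rightarrow> qbar) \<Rightarrow> ('n \<Rightarrow> qbar) \<Rightarrow> bool" where
  "proj_rel x y \<longleftrightarrow> x \<noteq> (\<lambda>_. 0) \<and> y \<noteq> (\<lambda>_. 0) \<and> (\<exists>c. c \<noteq> 0 \<and> y = (\<lambda>i. c * x i))"

lemma part_equivp_proj_rel: "part_equivp (proj_rel :: ('n::finite \<Rightarrow> qbar) \<Rightarrow> _)"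
proof (rule part_equivpI)
  have "proj_rel (\<lambda>_. 1) ((\<lambda>_. 1) :: 'n \<Rightarrow> qbar)"
    by (auto simp: proj_rel_def fun_eq_iff intro!: exI[of _ 1])
  then show "\<exists>x :: 'n \<Rightarrow> qbar. proj_rel x x" by blast
  show "symp (proj_rel :: ('n \<Rightarrow> qbar) \<Rightarrow> _)"
  proof (rule sympI)
    fix x y :: "'n \<Rightarrow> qbar"
    assume "proj_rel x y"
    then obtain c where "c \<noteq> 0" "y = (\<lambda>i. c * x i)" "x \<noteq> (\<lambda>_. 0)" "y \<noteq> (\<lambda>_. 0)"
      by (auto simp: proj_rel_def)
    then show "proj_rel y x"
      unfolding proj_rel_def by (intro conjI exI[of _ "inverse c"]) (auto simp: fun_eq_iff)
  qed
  show "transp (proj_rel :: ('n \<Rightarrow> qbar) \<Rightarrow> _)"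
  proof (rule transpI)
    fix x y z :: "'n \<Rightarrow> qbar"
    assume "proj_rel x y" "proj_rel y z"
    then obtain c d where "c \<noteq> 0" "y = (\<lambda>i. c * x i)" "d \<noteq> 0" "z = (\<lambda>i. d * y i)"
        "x \<noteq> (\<lambda>_. 0)" "z \<noteq> (\<lambda>_. 0)"
      by (auto simp: proj_rel_def)
    then show "proj_rel x z"
      unfolding proj_rel_def by (intro conjI exI[of _ "d * c"]) (auto simp: fun_eq_iff)
  qed
qed

quotient_type 'n proj = "'n::finite \<Rightarrow> qbar" / partial: proj_rel
  by (rule part_equivp_proj_rel)


section \<open>The absolute logarithmic Weil height\<close>

definition rat_scale :: "rat \<Rightarrow> qbar \<Rightarrow> qbar" where
  "rat_scale q x = of_rat q * x"

definition number_field :: "qbar set \<Rightarrow> bool" where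
  "number_field K \<longleftrightarrow>
     1 \<in> K \<and> (\<forall>x\<in>K. \<forall>y\<in>K. x - y \<in> K \<and> x * y \<in> K) \<and> (\<forall>x\<in>K. inverse x \<in> K) \<and>
     (\<exists>A. finite A \<and> module.span rat_scale A = K)"

definition nf_degree :: "qbar set \<Rightarrow> nat" where
  "nf_degree K = vector_space.dim rat_scale K"

text \<open>The functions in the next two definitions are made \<open>extensional\<close> so that each embedding and
  each valuation of \<open>K\<close> is represented by exactly one function on \<open>qbar\<close>.\<close>

definition complex_embeddings :: "qbar set \<Rightarrow> (qbar \<Rightarrow> complex) set" where
  "complex_embeddings K = {\<sigma> \<in> extensional K. \<sigma> 1 = 1 \<and>
     (\<forall>x\<in>K. \<forall>y\<in>K. \<sigma> (x + y) = \<sigma> x + \<sigma> y \<and> \<sigma> (x * y) = \<sigma> x * \<sigma> y)}"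

text \<open>The finite places of \<open>K\<close> are given by the normalized discrete valuations, that is, those with
  value group \<open>\<int>\<close>.\<close>

definition discrete_valuations :: "qbar set \<Rightarrow> (qbar \<Rightarrow> int) set" where
  "discrete_valuations K = {v \<in> extensional (K - {0}).
     v ` (K - {0}) = UNIV \<and>
     (\<forall>x\<in>K - {0}. \<forall>y\<in>K - {0}. v (x * y) = v x + v y) \<and>
     (\<forall>x\<in>K - {0}. \<forall>y\<in>K - {0}. x + y \<noteq> 0 \<longrightarrow> min (v x) (v y) \<le> v (x + y))}"

definition valuation_ring :: "qbar set \<Rightarrow> (qbar \<Rightarrow> int) \<Rightarrow> qbar set" where
  "valuation_ring K v = {x \<in> K. x = 0 \<or> 0 \<le> v x}"

definition residue_card :: "qbar set \<Rightarrow> (qbar \<Rightarrow> int) \<Rightarrow> nat" where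
  "residue_card K v = card (valuation_ring K v //
     {(x, y). x \<in> valuation_ring K v \<and> y \<in> valuation_ring K v \<and> (x = y \<or> 0 < v (x - y))})"

text \<open>If \<open>v\<close> lies over the prime \<open>p\<close>, this is the power with exponent \<open>[K\<^sub>v : \<rat>\<^sub>p]\<close> of the absolute
  value on \<open>K\<close> that extends the \<open>p\<close>-adic absolute value of the rationals.\<close>

definition finite_abs :: "qbar set \<Rightarrow> (qbar \<Rightarrow> int) \<Rightarrow> qbar \<Rightarrow> real" where
  "finite_abs K v x = (if x = 0 then 0 else real (residue_card K v) powi (- v x))"

text \<open>A complex place corresponds to two conjugate embeddings, so the sum over the embeddings counts
  every archimedean place with its local degree. In the second sum all but finitely many
  terms vanish.\<close>

definition height_over :: "qbar set \<Rightarrow> ('n::finite \<Rightarrow> qbar) \<Rightarrow> real" where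
  "height_over K x =
     ((\<Sum>\<sigma>\<in>complex_embeddings K. ln (MAX i. cmod (\<sigma> (x i)))) +
      (\<Sum>\<^sub>\<infinity>v\<in>discrete_valuations K. ln (MAX i. finite_abs K v (x i)))) / real (nf_degree K)"

text \<open>The value does not depend on the choice of homogeneous coordinates and of the number field
  containing them.\<close>

definition weil_height :: "'n::finite proj \<Rightarrow> real" where
  "weil_height P = (THE r. \<forall>K x. number_field K \<and> range x \<subseteq> K \<and> x \<noteq> (\<lambda>_. 0) \<and> abs_proj x = P
     \<longrightarrow> r = height_over K x)"


section \<open>Endomorphisms of projective space\<close>

text \<open>Polynomials with variables indexed by \<open>'n\<close>: finitely supported functions from exponent
  vectors to coefficients.\<close>

type_synonym 'n qbar_mpoly = "('n \<Rightarrow>\<^sub>0 nat) \<Rightarrow>\<^sub>0 qbar"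

definition mpoly_eval :: "'n::finite qbar_mpoly \<Rightarrow> ('n \<Rightarrow> qbar) \<Rightarrow> qbar" where
  "mpoly_eval F x =
     (\<Sum>m\<in>Poly_Mapping.keys F. Poly_Mapping.lookup F m * (\<Prod>i\<in>UNIV. x i ^ Poly_Mapping.lookup m i))"

definition homogeneous :: "nat \<Rightarrow> 'n::finite qbar_mpoly \<Rightarrow> bool" where
  "homogeneous d F \<longleftrightarrow>
     (\<forall>m\<in>Poly_Mapping.keys F. (\<Sum>i\<in>UNIV. Poly_Mapping.lookup m i) = d)"

definition defined_by ::
    "('n::finite proj \<Rightarrow> 'n proj) \<Rightarrow> nat \<Rightarrow> ('n \<Rightarrow> 'n qbar_mpoly) \<Rightarrow> bool" where
  "defined_by \<phi> d F \<longleftrightarrow>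
     (\<forall>i. homogeneous d (F i)) \<and>
     (\<forall>x. x \<noteq> (\<lambda>_. 0) \<longrightarrow> (\<exists>i. mpoly_eval (F i) x \<noteq> 0)) \<and>
     (\<forall>x. x \<noteq> (\<lambda>_. 0) \<longrightarrow> \<phi> (abs_proj x) = abs_proj (\<lambda>i. mpoly_eval (F i) x))"

definition endomorphism :: "('n::finite proj \<Rightarrow> 'n proj) \<Rightarrow> bool" where
  "endomorphism \<phi> \<longleftrightarrow> (\<exists>d F. defined_by \<phi> d F)"

text \<open>In dimension at least one the degree is uniquely determined by the map.\<close>

definition endo_degree :: "('n::finite proj \<Rightarrow> 'n proj) \<Rightarrow> nat" where
  "endo_degree \<phi> = (THE d. \<exists>F. defined_by \<phi> d F)"


section \<open>Monoids generated by endomorphisms\<close>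

inductive_set generated_monoid :: "('a \<Rightarrow> 'a) set \<Rightarrow> ('a \<Rightarrow> 'a) set" for S where
  id: "id \<in> generated_monoid S"
| gen: "f \<in> S \<Longrightarrow> f \<in> generated_monoid S"
| comp: "f \<in> generated_monoid S \<Longrightarrow> g \<in> generated_monoid S \<Longrightarrow> f \<circ> g \<in> generated_monoid S"

definition commutative_monoid :: "('a \<Rightarrow> 'a) set \<Rightarrow> bool" where
  "commutative_monoid M \<longleftrightarrow> (\<forall>f\<in>M. \<forall>g\<in>M. f \<circ> g = g \<circ> f)"

definition monomial_map :: "nat \<Rightarrow> (nat \<Rightarrow> 'a \<Rightarrow> 'a) \<Rightarrow> (nat \<Rightarrow> nat) \<Rightarrow> 'a \<Rightarrow> 'a" where
  "monomial_map s \<phi> e = foldr (\<circ>) (map (\<lambda>i. \<phi> i ^^ e i) [1..<Suc s]) id"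

definition free_basis :: "nat \<Rightarrow> (nat \<Rightarrow> 'a \<Rightarrow> 'a) \<Rightarrow> ('a \<Rightarrow> 'a) set \<Rightarrow> bool" where
  "free_basis s \<phi> M \<longleftrightarrow>
     (\<forall>f\<in>M. \<exists>!e. e \<in> extensional {1..s} \<and> f = monomial_map s \<phi> e)"


section \<open>Height constants\<close>

text \<open>The suprema are taken in the extended reals, where they exist without a prior proof that they
  are finite.\<close>

definition height_defect :: "('n::finite proj \<Rightarrow> 'n proj) \<Rightarrow> ereal" where
  "height_defect \<phi> =
     (SUP P. ereal \<bar>weil_height (\<phi> P) - real (endo_degree \<phi>) * weil_height P\<bar>)"

definition max_defect :: "('n::finite proj \<Rightarrow> 'n proj) set \<Rightarrow> ereal" where
  "max_defect S = (SUP \<phi>\<in>S. height_defect \<phi>)"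

definition min_degree :: "('n::finite proj \<Rightarrow> 'n proj) set \<Rightarrow> nat" where
  "min_degree S = (INF \<phi>\<in>S. endo_degree \<phi>)"

definition height_bound :: "('n::finite proj \<Rightarrow> 'n proj) set \<Rightarrow> ereal" where
  "height_bound S = max_defect S / ereal (real (min_degree S) - 1)"

end

theory Submission
  imports Defs
begin

text \<open>Put \<open>b = B_S\<close>. Since \<open>C_S = (d_S - 1) b\<close>, every \<open>\<phi> \<in> S\<close> of degree \<open>d\<close> satisfies
  \<open>h (\<phi> Q) - b \<ge> d (h Q - b)\<close> and \<open>h (\<phi> Q) + b \<le> d (h Q + b)\<close>. Iterating, \<open>h (f P)\<close> lies between
  two positive multiples of \<open>\<Prod>d\<^sub>i ^ e\<^sub>i\<close> when \<open>f = \<phi>\<^sub>1 ^ e\<^sub>1 \<circ> \<dots> \<circ> \<phi>\<^sub>s ^ e\<^sub>s\<close>, so up to a bounded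
  shift of \<open>ln B\<close> one counts the lattice points of the simplex \<open>\<Sum>e\<^sub>i ln d\<^sub>i \<le> ln B\<close>, whose volume is
  \<open>(ln B)^s / (s! \<Prod>ln d\<^sub>i)\<close>. Finiteness of \<open>C_S\<close> is implicit in \<open>h P > B_S\<close>.\<close>

section \<open>Lattice points in a simplex\<close>

text \<open>Extensionality makes each lattice point a single function, as for the exponent vectors
  in \<open>free_basis\<close>.\<close>

definition simplex_points :: "'i set \<Rightarrow> ('i \<Rightarrow> real) \<Rightarrow> real \<Rightarrow> ('i \<Rightarrow> nat) set" where
  "simplex_points I a T = {e \<in> extensional I. (\<Sum>i\<in>I. real (e i) * a i) \<le> T}"

lemma finite_simplex_points:
  assumes "finite I" and pos: "\<And>i. i \<in> I \<Longrightarrow> a i > 0"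
  shows "finite (simplex_points I a T)"
proof (rule finite_subset)
  show "simplex_points I a T \<subseteq> PiE I (\<lambda>i. {..nat \<lfloor>T / a i\<rfloor>})"
  proof
    fix e assume e: "e \<in> simplex_points I a T"
    have "e i \<le> nat \<lfloor>T / a i\<rfloor>" if "i \<in> I" for i
    proof -
      have "real (e i) * a i \<le> (\<Sum>i\<in>I. real (e i) * a i)"
        using assms that by (intro member_le_sum) (auto simp: less_imp_le)
      also have "\<dots> \<le> T"
        using e by (simp add: simplex_points_def)
      finally have "real (e i) \<le> T / a i"
        using pos[OF that] by (simp add: field_simps)
      then show ?thesis by linarith
    qed
    then show "e \<in> PiE I (\<lambda>i. {..nat \<lfloor>T / a i\<rfloor>})"
      using e by (auto simp: simplex_points_def PiE_def)
  qed
  show "finite (PiE I (\<lambda>i. {..nat \<lfloor>T / a i\<rfloor>}))"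
    using assms by (intro finite_PiE) auto
qed

lemma simplex_points_negative:
  assumes "\<And>i. i \<in> I \<Longrightarrow> a i > 0" and "T < 0"
  shows "simplex_points I a T = {}"
proof -
  have "(\<Sum>i\<in>I. real (e i) * a i) \<ge> 0" for e
    using assms(1) by (intro sum_nonneg) (simp add: less_imp_le)
  then show ?thesis
    using assms(2) by (auto simp: simplex_points_def not_le intro: less_le_trans)
qed

text \<open>The points with \<open>e j = 0\<close> form the simplex one dimension lower; from the
  others one unit of \<open>e j\<close> can be removed at the price \<open>a j\<close>.\<close>

lemma simplex_points_insert_split:
  assumes "finite I" and "j \<notin> I"
  shows "simplex_points (insert j I) a T =
    (\<lambda>e. e(j := 0)) ` simplex_points I a T \<union>
    (\<lambda>e. e(j := Suc (e j))) ` simplex_points (insert j I) a (T - a j)" (is "?L = ?A \<union> ?B")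
proof
  have sum_upd: "(\<Sum>i\<in>I. real ((e(j := k)) i) * a i) = (\<Sum>i\<in>I. real (e i) * a i)" for e k
    using assms(2) by (intro sum.cong) auto
  show "?A \<union> ?B \<subseteq> ?L"
    using assms sum_upd by (auto simp: simplex_points_def extensional_def algebra_simps)
  show "?L \<subseteq> ?A \<union> ?B"
  proof
    fix e assume e: "e \<in> ?L"
    show "e \<in> ?A \<union> ?B"
    proof (cases "e j")
      case 0
      \<comment> \<open>An extensional function is \<open>undefined\<close> outside
        \<open>I\<close>, so this is the value to restore at \<open>j\<close>.\<close>
      have "e = (e(j := undefined))(j := 0)"
        using 0 by auto
      moreover have "e(j := undefined) \<in> simplex_points I a T"
        using e assms 0 sum_upd[of e undefined] by (auto simp: simplex_points_def extensional_def)
      ultimately show ?thesis by blast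
    next
      case (Suc k)
      have "e = (e(j := k))(j := Suc ((e(j := k)) j))"
        using Suc by auto
      moreover have "e(j := k) \<in> simplex_points (insert j I) a (T - a j)"
        using e assms Suc sum_upd[of e k]
        by (auto simp: simplex_points_def extensional_def algebra_simps)
      ultimately show ?thesis by blast
    qed
  qed
qed

text \<open>Coordinate \<open>j\<close> is zero in one image of the splitting and positive in the
  other, so the cardinalities add. This gives a recurrence in \<open>T\<close> with step
  \<open>a j\<close> instead of a sum over slices.\<close>

lemma card_simplex_points_insert:
  assumes "finite I" and "j \<notin> I" and pos: "\<And>i. i \<in> insert j I \<Longrightarrow> a i > 0"
  shows "card (simplex_points (insert j I) a T) =
    card (simplex_points I a T) + card (simplex_points (insert j I) a (T - a j))"
proof -
  let ?f = "\<lambda>e::'a \<Rightarrow> nat. e(j := 0)" and ?g = "\<lambda>e::'a \<Rightarrow> nat. e(j := Suc (e j))"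
  have "inj_on ?f (simplex_points I a T)"
  proof (rule inj_onI)
    fix e e' assume *: "e \<in> simplex_points I a T" "e' \<in> simplex_points I a T" "?f e = ?f e'"
    show "e = e'"
    proof
      fix i
      \<comment> \<open>Overwriting coordinate \<open>j\<close> loses nothing, since both functions
        are \<open>undefined\<close> there.\<close>
      have "e j = e' j"
        using * assms(2) by (simp add: simplex_points_def extensional_def)
      moreover have "e i = e' i" if "i \<noteq> j"
        using fun_cong[OF *(3), of i] that by simp
      ultimately show "e i = e' i" by (cases "i = j") auto
    qed
  qed
  moreover have "inj_on ?g (simplex_points (insert j I) a (T - a j))"
  proof (rule inj_onI)
    fix e e' assume *: "?g e = ?g e'"
    show "e = e'"
    proof
      fix i
      show "e i = e' i"
        using fun_cong[OF *, of i] by (cases "i = j") auto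
    qed
  qed
  moreover have "?f ` simplex_points I a T \<inter> ?g ` simplex_points (insert j I) a (T - a j) = {}"
    by (auto dest: fun_cong[of _ _ j])
  moreover have "finite (simplex_points I a T)"
      "finite (simplex_points (insert j I) a (T - a j))"
    using assms by (auto intro!: finite_simplex_points)
  ultimately show ?thesis
    by (subst simplex_points_insert_split[OF assms(1,2)], subst card_Un_disjoint)
      (auto simp: card_image)
qed

section \<open>Volume bounds for the lattice point count\<close>

text \<open>The difference factors as \<open>x - y\<close> times a sum of \<open>Suc n\<close>
  terms, each between \<open>y ^ n\<close> and \<open>x ^ n\<close>. This replaces integration over
  slices of the simplex.\<close>

lemma power_Suc_diff_bounds:
  fixes x y :: real
  assumes "0 \<le> y" and "y \<le> x"
  shows "x ^ Suc n - y ^ Suc n \<le> real (Suc n) * (x - y) * x ^ n"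
    and "real (Suc n) * (x - y) * y ^ n \<le> x ^ Suc n - y ^ Suc n"
proof -
  have eq: "x ^ Suc n - y ^ Suc n = (x - y) * (\<Sum>i<Suc n. y ^ (n - i) * x ^ i)"
    using power_diff_sumr2[of x "Suc n" y] by simp
  have "(\<Sum>i<Suc n. y ^ (n - i) * x ^ i) \<le> (\<Sum>i<Suc n. x ^ n)"
  proof (rule sum_mono)
    fix i assume "i \<in> {..<Suc n}"
    then have "x ^ n = x ^ (n - i) * x ^ i"
      by (simp flip: power_add)
    then show "y ^ (n - i) * x ^ i \<le> x ^ n"
      using assms by (auto intro!: mult_right_mono power_mono)
  qed
  then show "x ^ Suc n - y ^ Suc n \<le> real (Suc n) * (x - y) * x ^ n"
    unfolding eq using assms mult_left_mono[of _ _ "x - y"] by (fastforce simp: mult_ac)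
  have "(\<Sum>i<Suc n. y ^ n) \<le> (\<Sum>i<Suc n. y ^ (n - i) * x ^ i)"
  proof (rule sum_mono)
    fix i assume "i \<in> {..<Suc n}"
    then have "y ^ n = y ^ (n - i) * y ^ i"
      by (simp flip: power_add)
    then show "y ^ n \<le> y ^ (n - i) * x ^ i"
      using assms by (auto intro!: mult_left_mono power_mono)
  qed
  then show "real (Suc n) * (x - y) * y ^ n \<le> x ^ Suc n - y ^ Suc n"
    unfolding eq using assms mult_left_mono[of _ _ "x - y"] by (fastforce simp: mult_ac)
qed

text \<open>As \<open>a > 0\<close>, finitely many subtractions make any real \<open>T\<close>
  negative, so this is ordinary induction on the number of steps.\<close>

lemma descent_induct:
  fixes T a :: real
  assumes "a > 0" and neg: "\<And>T. T < 0 \<Longrightarrow> Q T" and step: "\<And>T. T \<ge> 0 \<Longrightarrow> Q (T - a) \<Longrightarrow> Q T"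
  shows "Q T"
proof -
  have "T < real n * a \<Longrightarrow> Q T" for n T
  proof (induction n arbitrary: T)
    case (Suc n)
    then show ?case
      using neg step by (cases "T < 0") (auto simp: algebra_simps)
  qed (use neg in auto)
  moreover obtain n where "T / a < real n"
    using reals_Archimedean2 by blast
  ultimately show ?thesis
    using assms(1) by (simp add: field_simps)
qed

text \<open>Geometrically, boxes with sides \<open>a i\<close> placed at the points
  \<open>e i * a i\<close> cover the simplex of size \<open>T\<close>. The proof is an induction on
  the dimension with a descent in \<open>T\<close> inside.\<close>

lemma card_simplex_points_lower:
  assumes "finite I" and "\<And>i. i \<in> I \<Longrightarrow> a i > 0" and "T \<ge> 0"
  shows "T ^ card I \<le> fact (card I) * (\<Prod>i\<in>I. a i) * real (card (simplex_points I a T))"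
  using assms
proof (induction I arbitrary: T rule: finite_induct)
  case empty
  then show ?case by (simp add: simplex_points_def)
next
  case (insert j I)
  define n where "n = card I"
  define p where "p = (\<Prod>i\<in>I. a i)"
  define c where "c T = real (card (simplex_points I a T))" for T
  define c' where "c' T = real (card (simplex_points (insert j I) a T))" for T
  have pos: "a j > 0" "p > 0"
    using insert.prems insert.hyps by (auto simp: p_def prod_pos)
  have rec: "c' T = c T + c' (T - a j)" for T
    using card_simplex_points_insert[of I j a T] insert.prems insert.hyps
    by (simp add: c_def c'_def)
  \<comment> \<open>Truncation at 0 extends the claim to negative \<open>T\<close>, where the
    recurrence ends and the left side vanishes.\<close>
  have "max T 0 ^ Suc n \<le> fact (Suc n) * (a j * p) * c' T" for T
  proof (induction T rule: descent_induct[OF pos(1)])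
    case (1 T)
    then show ?case using pos by (auto simp: c'_def)
  next
    case (2 T)
    let ?m = "max (T - a j) 0"
    have "T ^ Suc n - ?m ^ Suc n \<le> real (Suc n) * (T - ?m) * T ^ n"
      using 2(1) pos by (intro power_Suc_diff_bounds) auto
    \<comment> \<open>Here \<open>T - ?m \<le> a j\<close>, since truncation can only shorten the
      step; the last factor comes from the bound in dimension \<open>n\<close>.\<close>
    also have "\<dots> \<le> real (Suc n) * a j * (fact n * p * c T)"
      using insert.IH[of T] insert.prems 2(1) pos
      by (intro mult_mono) (auto simp: n_def p_def c_def less_imp_le)
    finally show ?case
      using 2 rec[of T] by (simp add: algebra_simps)
  qed
  from this[of T] show ?case
    using insert.prems insert.hyps by (simp add: n_def p_def c'_def del: power_Suc fact_Suc)
qed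

text \<open>The same boxes lie inside the simplex enlarged to size
  \<open>T + (\<Sum>i\<in>I. a i)\<close>. The sign condition matters because odd powers of a
  negative base are negative while the count is 0.\<close>

lemma card_simplex_points_upper:
  assumes "finite I" and "\<And>i. i \<in> I \<Longrightarrow> a i > 0" and "T + (\<Sum>i\<in>I. a i) \<ge> 0"
  shows "fact (card I) * (\<Prod>i\<in>I. a i) * real (card (simplex_points I a T))
    \<le> (T + (\<Sum>i\<in>I. a i)) ^ card I"
  using assms
proof (induction I arbitrary: T rule: finite_induct)
  case empty
  then show ?case by (simp add: simplex_points_def)
next
  case (insert j I)
  define n where "n = card I"
  define p where "p = (\<Prod>i\<in>I. a i)"
  define A where "A = (\<Sum>i\<in>I. a i)"
  define c where "c T = real (card (simplex_points I a T))" for T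
  define c' where "c' T = real (card (simplex_points (insert j I) a T))" for T
  have pos: "a j > 0" "p > 0" "A \<ge> 0"
    using insert.prems insert.hyps by (auto simp: p_def A_def prod_pos less_imp_le sum_nonneg)
  have rec: "c' T = c T + c' (T - a j)" for T
    using card_simplex_points_insert[of I j a T] insert.prems insert.hyps
    by (simp add: c_def c'_def)
  \<comment> \<open>The descent runs over all real \<open>T\<close>, so the sign condition becomes a
    premise; at \<open>T - a j\<close> it reads \<open>T + A \<ge> 0\<close>, which holds for
    \<open>T \<ge> 0\<close>.\<close>
  have "T + A + a j \<ge> 0 \<longrightarrow> fact (Suc n) * (a j * p) * c' T \<le> (T + A + a j) ^ Suc n" for T
  proof (induction T rule: descent_induct[OF pos(1)])
    case (1 T)
    then have "c' T = 0"
      using simplex_points_negative[of "insert j I" a T] insert.prems by (simp add: c'_def)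
    then show ?case by simp
  next
    case (2 T)
    have "real (Suc n) * a j * (fact n * p * c T) \<le> real (Suc n) * a j * (T + A) ^ n"
      using insert.IH[of T] insert.prems 2(1) pos
      by (intro mult_left_mono mult_nonneg_nonneg) (auto simp: n_def p_def c_def A_def less_imp_le)
    also have "\<dots> \<le> (T + A + a j) ^ Suc n - (T + A) ^ Suc n"
      using power_Suc_diff_bounds(2)[of "T + A" "T + A + a j" n] 2(1) pos by simp
    finally show ?case
      using 2 rec[of T] pos by (simp add: algebra_simps)
  qed
  from this[of T] show ?case
    using insert.prems insert.hyps
    by (simp add: n_def p_def c'_def A_def add_ac del: power_Suc fact_Suc)
qed

text \<open>A constant shift of \<open>T\<close> does not change the leading term of its powers, so
  the two simplex counts squeeze \<open>count\<close> to the same limit.\<close>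

lemma simplex_count_asymptotics:
  fixes count :: "real \<Rightarrow> nat"
  assumes "finite I" and pos: "\<And>i. i \<in> I \<Longrightarrow> a i > 0"
    and lower: "\<And>T. card (simplex_points I a (T - u)) \<le> count T"
    and upper: "\<And>T. count T \<le> card (simplex_points I a (T - v))"
  shows "((\<lambda>T. real (count T) / T ^ card I) \<longlongrightarrow> 1 / (fact (card I) * (\<Prod>i\<in>I. a i))) at_top"
proof -
  define n where "n = card I"
  define k where "k = fact n * (\<Prod>i\<in>I. a i)"
  define A where "A = (\<Sum>i\<in>I. a i)"
  have k: "k > 0"
    using pos by (auto simp: k_def prod_pos)
  have lim: "((\<lambda>T::real. ((T + x) / T) ^ n / k) \<longlongrightarrow> 1 / k) at_top" for x
  proof -
    have "((\<lambda>T::real. 1 + x / T) \<longlongrightarrow> 1 + 0) at_top"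
      by (intro tendsto_intros tendsto_divide_0[OF tendsto_const]
          filterlim_at_top_imp_at_infinity filterlim_ident)
    moreover have "\<forall>\<^sub>F T in at_top. 1 + x / T = (T + x) / T"
      using eventually_gt_at_top[of 0] by eventually_elim (simp add: field_simps)
    ultimately have "((\<lambda>T::real. (T + x) / T) \<longlongrightarrow> 1) at_top"
      using tendsto_cong by fastforce
    then have "((\<lambda>T::real. ((T + x) / T) ^ n / k) \<longlongrightarrow> 1 ^ n / k) at_top"
      using k by (intro tendsto_intros) auto
    then show ?thesis by simp
  qed
  have "((\<lambda>T. real (count T) / T ^ n) \<longlongrightarrow> 1 / k) at_top"
  proof (rule tendsto_sandwich[OF _ _ lim[of "- u"] lim[of "A - v"]])
    show "\<forall>\<^sub>F T in at_top. ((T + - u) / T) ^ n / k \<le> real (count T) / T ^ n"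
      \<comment> \<open>The thresholds here and below keep \<open>T\<close> and the base of the
        shifted power positive.\<close>
      using eventually_gt_at_top[of "max 0 u"]
    proof eventually_elim
      case (elim T)
      have "(T - u) ^ n \<le> k * real (card (simplex_points I a (T - u)))"
        using card_simplex_points_lower[OF assms(1) pos, where T = "T - u"] elim
        by (simp add: k_def n_def)
      also have "\<dots> \<le> k * real (count T)"
        using k lower by simp
      finally show ?case
        using elim k by (simp add: power_divide field_simps)
    qed
    show "\<forall>\<^sub>F T in at_top. real (count T) / T ^ n \<le> ((T + (A - v)) / T) ^ n / k"
      using eventually_gt_at_top[of "max 0 (v - A)"]
    proof eventually_elim
      case (elim T)
      have "k * real (count T) \<le> k * real (card (simplex_points I a (T - v)))"
        using k upper by simp
      also have "\<dots> \<le> (T - v + A) ^ n"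
        using card_simplex_points_upper[OF assms(1) pos, where T = "T - v"] elim
        by (simp add: k_def n_def A_def)
      finally show ?case
        using elim k by (simp add: power_divide field_simps)
    qed
  qed
  then show ?thesis
    by (simp add: n_def k_def)
qed


section \<open>Monomials in the generators\<close>

text \<open>\<open>free_basis\<close> speaks only of elements of the monoid; this brings its
  uniqueness clause to bear on every monomial.\<close>

lemma monomial_map_in_generated_monoid:
  "monomial_map s \<phi> e \<in> generated_monoid (\<phi> ` {1..s})"
proof -
  have power: "f ^^ k \<in> generated_monoid S" if "f \<in> S" for f :: "'a \<Rightarrow> 'a" and S k
    using that by (induction k) (auto simp: generated_monoid.id[unfolded id_def]
        intro: generated_monoid.intros)
  have "foldr (\<circ>) (map (\<lambda>i. \<phi> i ^^ e i) xs) id \<in> generated_monoid (\<phi> ` {1..s})"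
    if "set xs \<subseteq> {1..s}" for xs
    using that by (induction xs) (auto intro!: generated_monoid.id generated_monoid.comp power)
  then show ?thesis
    unfolding monomial_map_def by (metis atLeastLessThanSuc_atLeastAtMost order_refl set_upt)
qed

lemma generated_monoid_empty: "generated_monoid {} = {id}"
proof -
  have "f = id" if "f \<in> generated_monoid {}" for f :: "'a \<Rightarrow> 'a"
    using that by induction auto
  then show ?thesis by (auto intro: generated_monoid.id)
qed

text \<open>\<open>g\<close> may take negative values, since the induction only multiplies
  inequalities by powers of the nonnegative \<open>d i\<close>. So the lemma serves for
  \<open>h - b\<close> and, to get upper bounds, for \<open>- (h + b)\<close>.\<close>

lemma monomial_map_growth:
  fixes g :: "'a \<Rightarrow> real"
  assumes growth: "\<And>i Q. i \<in> {1..s} \<Longrightarrow> d i * g Q \<le> g (\<phi> i Q)"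
    and nonneg: "\<And>i. i \<in> {1..s} \<Longrightarrow> d i \<ge> 0"
  shows "(\<Prod>i=1..s. d i ^ e i) * g P \<le> g (monomial_map s \<phi> e P)"
proof -
  have power: "d i ^ k * g Q \<le> g ((\<phi> i ^^ k) Q)" if i: "i \<in> {1..s}" for i k Q
  proof (induction k)
    case (Suc k)
    have "d i ^ Suc k * g Q \<le> d i * g ((\<phi> i ^^ k) Q)"
      using mult_left_mono[OF Suc nonneg[OF i]] by (simp add: mult_ac)
    also have "\<dots> \<le> g ((\<phi> i ^^ Suc k) Q)"
      using growth[OF i] by simp
    finally show ?case .
  qed simp
  \<comment> \<open>Passing to arbitrary index lists lets the induction peel off the head, the
    factor applied last.\<close>
  have "(\<Prod>i\<leftarrow>xs. d i ^ e i) * g P \<le> g (foldr (\<circ>) (map (\<lambda>i. \<phi> i ^^ e i) xs) id P)"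
    if "set xs \<subseteq> {1..s}" for xs
    using that
  proof (induction xs)
    case (Cons i xs)
    let ?Q = "foldr (\<circ>) (map (\<lambda>i. \<phi> i ^^ e i) xs) id P"
    have "(\<Prod>i\<leftarrow>i # xs. d i ^ e i) * g P = d i ^ e i * ((\<Prod>i\<leftarrow>xs. d i ^ e i) * g P)"
      by simp
    also have "\<dots> \<le> d i ^ e i * g ?Q"
      using Cons.prems nonneg by (intro mult_left_mono[OF Cons.IH]) auto
    also have "\<dots> \<le> g ((\<phi> i ^^ e i) ?Q)"
      using Cons.prems by (intro power) simp
    finally show ?case unfolding list.map foldr.simps comp_apply .
  qed simp
  moreover have "(\<Prod>i\<leftarrow>[1..<Suc s]. d i ^ e i) = (\<Prod>i=1..s. d i ^ e i)"
    by (subst prod.distinct_set_conv_list[symmetric])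
      (simp_all only: distinct_upt set_upt atLeastLessThanSuc_atLeastAtMost)
  ultimately show ?thesis
    unfolding monomial_map_def
    by (metis atLeastLessThanSuc_atLeastAtMost order_refl set_upt)
qed

text \<open>Existence in \<open>free_basis\<close> makes \<open>monomial_map\<close> onto,
  uniqueness makes it injective. A bijection equates \<open>card\<close> even if the sets are
  infinite.\<close>

lemma card_generated_monoid:
  assumes "free_basis s \<phi> (generated_monoid (\<phi> ` {1..s}))"
  shows "card {f \<in> generated_monoid (\<phi> ` {1..s}). Q f} =
    card {e \<in> extensional {1..s}. Q (monomial_map s \<phi> e)}"
proof -
  let ?M = "generated_monoid (\<phi> ` {1..s})" and ?m = "monomial_map s \<phi>"
  have uniq: "\<exists>!e. e \<in> extensional {1..s} \<and> f = ?m e" if "f \<in> ?M" for f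
    using assms that by (simp add: free_basis_def)
  have mem: "?m e \<in> ?M" for e
    by (rule monomial_map_in_generated_monoid)
  have "bij_betw ?m {e \<in> extensional {1..s}. Q (?m e)} {f \<in> ?M. Q f}"
    unfolding bij_betw_def
  proof
    show "inj_on ?m {e \<in> extensional {1..s}. Q (?m e)}"
    proof (rule inj_onI)
      fix e e' assume "e \<in> {e \<in> extensional {1..s}. Q (?m e)}"
        "e' \<in> {e \<in> extensional {1..s}. Q (?m e)}" "?m e = ?m e'"
      then show "e = e'"
        using ex1E[OF uniq[OF mem[of e]]] by (metis (lifting) mem_Collect_eq)
    qed
    show "?m ` {e \<in> extensional {1..s}. Q (?m e)} = {f \<in> ?M. Q f}"
    proof
      show "{f \<in> ?M. Q f} \<subseteq> ?m ` {e \<in> extensional {1..s}. Q (?m e)}"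
      proof
        fix f assume f: "f \<in> {f \<in> ?M. Q f}"
        then obtain e where "e \<in> extensional {1..s}" "f = ?m e"
          using ex1_implies_ex[OF uniq[of f]] by auto
        then show "f \<in> ?m ` {e \<in> extensional {1..s}. Q (?m e)}"
          using f by simp
      qed
    qed (use mem in auto)
  qed
  from bij_betw_same_card[OF this] show ?thesis by simp
qed

section \<open>Counting an orbit by height\<close>

lemma orbit_count_asymptotics:
  fixes h :: "'a \<Rightarrow> real" and d :: "nat \<Rightarrow> real"
  assumes "free_basis s \<phi> (generated_monoid (\<phi> ` {1..s}))"
    and lower: "\<And>i Q. i \<in> {1..s} \<Longrightarrow> d i * (h Q - b) \<le> h (\<phi> i Q) - b"
    and upper: "\<And>i Q. i \<in> {1..s} \<Longrightarrow> h (\<phi> i Q) + b \<le> d i * (h Q + b)"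
    and d: "\<And>i. i \<in> {1..s} \<Longrightarrow> d i > 1"
    and b: "0 \<le> b" "b < h P"
  shows "((\<lambda>B. real (card {f \<in> generated_monoid (\<phi> ` {1..s}). h (f P) \<le> B}) / ln B ^ s)
           \<longlongrightarrow> 1 / (fact s * (\<Prod>i=1..s. ln (d i)))) at_top"
proof -
  let ?L = "simplex_points {1..s} (\<lambda>i. ln (d i))"
  define E where "E T = {e \<in> extensional {1..s}. h (monomial_map s \<phi> e P) \<le> exp T}" for T
  \<comment> \<open>\<open>D e * c\<close> and \<open>D e * c'\<close> will enclose the height;
    \<open>c > 0\<close> is where \<open>b < h P\<close> enters.\<close>
  define c where "c = h P - b"
  define c' where "c' = h P + b"
  \<comment> \<open>The exponential form turns \<open>D e * x \<le> exp T\<close> into a linear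
    condition on \<open>e\<close>.\<close>
  define D where "D e = exp (\<Sum>i=1..s. real (e i) * ln (d i))" for e :: "nat \<Rightarrow> nat"
  have cpos: "c > 0" "c' > 0"
    using b by (auto simp: c_def c'_def)
  have D: "D e = (\<Prod>i=1..s. d i ^ e i)" for e
    unfolding D_def exp_sum[OF finite_atLeastAtMost]
  proof (rule prod.cong[OF refl])
    fix i assume "i \<in> {1..s}"
    then have "d i > 0" using d[of i] by simp
    then show "exp (real (e i) * ln (d i)) = d i ^ e i"
      by (simp add: exp_of_nat_mult)
  qed
  have D_lower: "D e * c \<le> h (monomial_map s \<phi> e P)" for e
  proof -
    have "D e * (h P - b) \<le> h (monomial_map s \<phi> e P) - b"
      unfolding D
    proof (rule monomial_map_growth)
      fix i Q assume "i \<in> {1..s}"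
      then show "d i * (h Q - b) \<le> h (\<phi> i Q) - b" "d i \<ge> 0"
        using lower[of i Q] d[of i] by auto
    qed
    then show ?thesis using b by (simp add: c_def)
  qed
  have D_upper: "h (monomial_map s \<phi> e P) \<le> D e * c'" for e
  proof -
    \<comment> \<open>Negation turns the upper bound into a growth inequality, for
      \<open>- (h + b)\<close>.\<close>
    have "D e * - (h P + b) \<le> - (h (monomial_map s \<phi> e P) + b)"
      unfolding D
    proof (rule monomial_map_growth)
      fix i Q assume "i \<in> {1..s}"
      then show "d i * - (h Q + b) \<le> - (h (\<phi> i Q) + b)" "d i \<ge> 0"
        using upper[of i Q] d[of i] by (auto simp: algebra_simps)
    qed
    then show ?thesis using b by (simp add: c'_def algebra_simps)
  qed
  have iff: "D e * x \<le> exp T \<longleftrightarrow> (\<Sum>i=1..s. real (e i) * ln (d i)) \<le> T - ln x"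
    if "x > 0" for e x T
  proof -
    have "D e * x = exp ((\<Sum>i=1..s. real (e i) * ln (d i)) + ln x)"
      using that by (simp add: D_def exp_add)
    then show ?thesis by (simp add: algebra_simps)
  qed
  have sub: "E T \<subseteq> ?L (T - ln c)" "?L (T - ln c') \<subseteq> E T" for T
    unfolding E_def simplex_points_def iff[OF cpos(1), symmetric] iff[OF cpos(2), symmetric]
    using D_lower D_upper order_trans by blast+
  \<comment> \<open>Finiteness is essential for comparing cardinalities, because \<open>card\<close>
    of an infinite set is 0.\<close>
  have fin: "finite (?L T)" for T
    using d by (intro finite_simplex_points ln_gt_zero) auto
  have "((\<lambda>T. real (card (E T)) / T ^ card {1..s}) \<longlongrightarrow>
      1 / (fact (card {1..s}) * (\<Prod>i=1..s. ln (d i)))) at_top"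
  proof (rule simplex_count_asymptotics)
    show "card (?L (T - ln c')) \<le> card (E T)" for T
      using sub fin by (meson card_mono finite_subset)
    show "card (E T) \<le> card (?L (T - ln c))" for T
      using sub fin by (meson card_mono finite_subset)
  qed (use d in \<open>auto intro!: ln_gt_zero\<close>)
  from filterlim_compose[OF this ln_at_top]
  have "((\<lambda>B. real (card (E (ln B))) / ln B ^ s) \<longlongrightarrow>
      1 / (fact s * (\<Prod>i=1..s. ln (d i)))) at_top"
    by simp
  \<comment> \<open>\<open>exp (ln B) = B\<close> holds only for \<open>B > 0\<close>, hence
    eventually.\<close>
  moreover have "\<forall>\<^sub>F B in at_top. real (card (E (ln B))) / ln B ^ s =
      real (card {f \<in> generated_monoid (\<phi> ` {1..s}). h (f P) \<le> B}) / ln B ^ s"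
    using eventually_gt_at_top[of 0]
    by eventually_elim (simp only: E_def exp_ln card_generated_monoid[OF assms(1)])
  ultimately show ?thesis
    by (rule Lim_transform_eventually)
qed

text \<open>B_S is taken from the extended reals to a real \<open>b\<close>. As every degree is at
  least d_S, the constant C_S = (d_S - 1) b is at most
  \<open>(real (endo_degree f) - 1) * b\<close>.\<close>

lemma height_bound_witness:
  assumes ne: "S \<noteq> {}" and deg: "\<And>f. f \<in> S \<Longrightarrow> endo_degree f \<ge> 2"
    and P: "ereal (weil_height P) > height_bound S"
  obtains b where "0 \<le> b" "b < weil_height P"
    "\<And>f Q. f \<in> S \<Longrightarrow>
      \<bar>weil_height (f Q) - real (endo_degree f) * weil_height Q\<bar> \<le> (real (endo_degree f) - 1) * b"
proof -
  have min: "min_degree S \<ge> 2"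
    unfolding min_degree_def using ne deg by (intro cINF_greatest) auto
  define m where "m = real (min_degree S) - 1"
  have m: "m \<ge> 1" using min by (simp add: m_def)
  have def_le: "ereal \<bar>weil_height (f Q) - real (endo_degree f) * weil_height Q\<bar> \<le> max_defect S"
    if "f \<in> S" for f Q
    unfolding max_defect_def height_defect_def using that
    by (intro SUP_upper2[OF that] SUP_upper2[of Q]) auto
  obtain f where "f \<in> S" using ne by blast
  \<comment> \<open>Since \<open>S\<close> is nonempty, the supremum lies above some absolute
    value.\<close>
  then have nonneg: "max_defect S \<ge> 0"
    using order_trans[OF _ def_le[of f undefined]] by simp
  \<comment> \<open>An infinite C_S would stay infinite after division by the positive real
    \<open>m\<close> and could not lie below the height of \<open>P\<close>.\<close>
  have "max_defect S \<noteq> \<infinity>"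
    using P m by (auto simp: height_bound_def simp flip: m_def)
  with nonneg obtain C where C: "max_defect S = ereal C" "C \<ge> 0"
    by (cases "max_defect S") auto
  show thesis
  proof (rule that[of "C / m"])
    show "0 \<le> C / m" using C m by simp
    show "C / m < weil_height P"
      using P C m by (simp add: height_bound_def flip: m_def)
    fix f Q assume f: "f \<in> S"
    have "min_degree S \<le> endo_degree f"
      unfolding min_degree_def using f by (intro cINF_lower) auto
    then have "m * (C / m) \<le> (real (endo_degree f) - 1) * (C / m)"
      using C m by (intro mult_right_mono) (auto simp: m_def)
    moreover have "\<bar>weil_height (f Q) - real (endo_degree f) * weil_height Q\<bar> \<le> C"
      using def_le[OF f, of Q] C by simp
    ultimately show "\<bar>weil_height (f Q) - real (endo_degree f) * weil_height Q\<bar>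
        \<le> (real (endo_degree f) - 1) * (C / m)"
      using m by simp
  qed
qed

theorem mainTheorem5:
  fixes N s :: nat
    and \<phi> :: "nat \<Rightarrow> 'n::finite proj \<Rightarrow> 'n proj"
    and S :: "('n proj \<Rightarrow> 'n proj) set"
    and P :: "'n proj"
  assumes "N \<ge> 1" and "CARD('n) = N + 1"
    and "S = \<phi> ` {1..s}" and "inj_on \<phi> {1..s}"
    and "\<And>f. f \<in> S \<Longrightarrow> endomorphism f"
    and "\<And>f. f \<in> S \<Longrightarrow> endo_degree f \<ge> 2"
    and "commutative_monoid (generated_monoid S)"
    and "free_basis s \<phi> (generated_monoid S)"
    and "ereal (weil_height P) > height_bound S"
  shows "((\<lambda>B::real. real (card {f \<in> generated_monoid S. weil_height (f P) \<le> B}) / ln B ^ s)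
           \<longlongrightarrow> 1 / (fact s * (\<Prod>i=1..s. ln (real (endo_degree (\<phi> i)))))) at_top"
proof (cases "S = {}")
  \<comment> \<open>\<open>min_degree {}\<close>, an infimum of the empty set in \<open>nat\<close>, is unspecified, so this case is direct.\<close>
  case True
  then have "s = 0" using assms(3) by simp
  have "((\<lambda>B. real (card {f \<in> generated_monoid S. weil_height (f P) \<le> B}) / ln B ^ s) \<longlongrightarrow> 1) at_top"
  proof (rule tendsto_eventually)
    show "\<forall>\<^sub>F B in at_top.
        real (card {f \<in> generated_monoid S. weil_height (f P) \<le> B}) / ln B ^ s = 1"
      using eventually_ge_at_top[of "weil_height P"]
    proof eventually_elim
      case (elim B)
      then have "{f \<in> generated_monoid S. weil_height (f P) \<le> B} = {id}"
        by (auto simp: True generated_monoid_empty)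
      then show ?case using \<open>s = 0\<close> by simp
    qed
  qed
  then show ?thesis using \<open>s = 0\<close> by simp
next
  case False
  then obtain b where b: "0 \<le> b" "b < weil_height P"
    and defect: "\<And>f Q. f \<in> S \<Longrightarrow>
      \<bar>weil_height (f Q) - real (endo_degree f) * weil_height Q\<bar> \<le> (real (endo_degree f) - 1) * b"
    using height_bound_witness assms(6,9) by blast
  show ?thesis
    unfolding assms(3)
  proof (rule orbit_count_asymptotics[where b = b])
    show "free_basis s \<phi> (generated_monoid (\<phi> ` {1..s}))"
      using assms(3,8) by simp
    show "0 \<le> b" "b < weil_height P" by (fact b)+
    fix i assume "i \<in> {1..s}"
    then have i: "\<phi> i \<in> S" using assms(3) by blast
    show "real (endo_degree (\<phi> i)) > 1"
      using assms(6)[OF i] by simp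
    fix Q
    \<comment> \<open>These are the two halves of the absolute value bound, rearranged.\<close>
    show "real (endo_degree (\<phi> i)) * (weil_height Q - b) \<le> weil_height (\<phi> i Q) - b"
      "weil_height (\<phi> i Q) + b \<le> real (endo_degree (\<phi> i)) * (weil_height Q + b)"
      using defect[OF i, of Q] by (auto simp: abs_le_iff algebra_simps)
  qed
qed

end
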